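(* Let $p$ be a prime, let $G$ be a finitely generated pro-$p$ group and let $H\le G$. (a) If $\Phi(H)$ contains an almost primitive element of $G$, then $H=G$. (b) Every almost primitive element of $G$ is a test element of $G$.
   Context: Subgroups of pro-$p$ groups are closed, generation is topological, and homomorphisms are continuous. $\Phi(G)$ denotes the Frattini subgroup of $G$. An element of a pro-$p$ group $G$ is primitive if it is a member of a minimal generating set for $G$; equivalently, it lies in $G\setminus\Phi(G)$. An element $g\in G$ is almost primitive in $G$ if it is not primitive in $G$ but is a primitive element of every proper subgroup of $G$ that contains it. An element $g\in G$ is a test element of $G$ if every endomorphism $\varphi:G\to G$ with $\varphi(g)=g$ is an automorphism. *)

theory Defs
  imports "HOL-Algebra.Generated_Groups" "HOL-Analysis.Analysis" "HOL-Computational_Algebra.Primes"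
begin

text \<open>
  A topological group is a group \<open>G\<close> together with a topology \<open>T\<close> whose space is the carrier of \<open>G\<close>.
  A subset \<open>K\<close> of the carrier that is a subgroup is viewed as a topological group in its own right
  through the pair \<open>G\<lparr>carrier := K\<rparr>\<close>, \<open>subtopology T K\<close>.
\<close>

locale topological_group = group G for G (structure) +
  fixes T :: "'a topology"
  assumes topspace_eq_carrier: "topspace T = carrier G"
    and continuous_mult: "continuous_map (prod_topology T T) T (\<lambda>(x, y). x \<otimes> y)"
    and continuous_inv: "continuous_map T T (\<lambda>x. inv x)"

locale profinite_group = topological_group +
  assumes compact: "compact_space T"
    and Hausdorff: "Hausdorff_space T"
    and open_subgroups_base:
      "openin T U \<Longrightarrow> \<one> \<in> U \<Longrightarrow> \<exists>V. subgroup V G \<and> openin T V \<and> V \<subseteq> U"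

locale pro_p_group = profinite_group +
  fixes p :: nat
  assumes prime_p: "prime p"
    and open_normal_index: "N \<lhd> G \<Longrightarrow> openin T N \<Longrightarrow> \<exists>n. card (rcosets N) = p ^ n"

definition closed_subgroup :: "('a, 'b) monoid_scheme \<Rightarrow> 'a topology \<Rightarrow> 'a set \<Rightarrow> bool"
  where "closed_subgroup G T K \<longleftrightarrow> subgroup K G \<and> closedin T K"

definition topologically_generates :: "('a, 'b) monoid_scheme \<Rightarrow> 'a topology \<Rightarrow> 'a set \<Rightarrow> bool"
  where "topologically_generates G T X \<longleftrightarrow>
    X \<subseteq> carrier G \<and> T closure_of (generate G X) = carrier G"

definition topologically_finitely_generated :: "('a, 'b) monoid_scheme \<Rightarrow> 'a topology \<Rightarrow> bool"
  where "topologically_finitely_generated G T \<longleftrightarrow>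
    (\<exists>X. finite X \<and> topologically_generates G T X)"

definition minimal_generating_set :: "('a, 'b) monoid_scheme \<Rightarrow> 'a topology \<Rightarrow> 'a set \<Rightarrow> bool"
  where "minimal_generating_set G T X \<longleftrightarrow>
    topologically_generates G T X \<and> (\<forall>Y. Y \<subset> X \<longrightarrow> \<not> topologically_generates G T Y)"

definition maximal_closed_subgroup :: "('a, 'b) monoid_scheme \<Rightarrow> 'a topology \<Rightarrow> 'a set \<Rightarrow> bool"
  where "maximal_closed_subgroup G T M \<longleftrightarrow>
    closed_subgroup G T M \<and> M \<noteq> carrier G \<and>
    (\<forall>K. closed_subgroup G T K \<and> M \<subseteq> K \<longrightarrow> K = M \<or> K = carrier G)"

text \<open>Intersecting with the carrier makes the Frattini subgroup the whole group, rather than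
  \<open>UNIV\<close>, if there are no maximal subgroups.\<close>

definition frattini :: "('a, 'b) monoid_scheme \<Rightarrow> 'a topology \<Rightarrow> 'a set"
  where "frattini G T = carrier G \<inter> \<Inter>{M. maximal_closed_subgroup G T M}"

definition primitive :: "('a, 'b) monoid_scheme \<Rightarrow> 'a topology \<Rightarrow> 'a \<Rightarrow> bool"
  where "primitive G T g \<longleftrightarrow> (\<exists>X. minimal_generating_set G T X \<and> g \<in> X)"

definition almost_primitive :: "('a, 'b) monoid_scheme \<Rightarrow> 'a topology \<Rightarrow> 'a \<Rightarrow> bool"
  where "almost_primitive G T g \<longleftrightarrow>
    g \<in> carrier G \<and> \<not> primitive G T g \<and>
    (\<forall>K. closed_subgroup G T K \<and> K \<noteq> carrier G \<and> g \<in> K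
      \<longrightarrow> primitive (G\<lparr>carrier := K\<rparr>) (subtopology T K) g)"

definition continuous_endomorphism ::
    "('a, 'b) monoid_scheme \<Rightarrow> 'a topology \<Rightarrow> ('a \<Rightarrow> 'a) \<Rightarrow> bool"
  where "continuous_endomorphism G T \<phi> \<longleftrightarrow> \<phi> \<in> hom G G \<and> continuous_map T T \<phi>"

definition topological_automorphism ::
    "('a, 'b) monoid_scheme \<Rightarrow> 'a topology \<Rightarrow> ('a \<Rightarrow> 'a) \<Rightarrow> bool"
  where "topological_automorphism G T \<phi> \<longleftrightarrow> \<phi> \<in> iso G G \<and> homeomorphic_map T T \<phi>"

definition test_element :: "('a, 'b) monoid_scheme \<Rightarrow> 'a topology \<Rightarrow> 'a \<Rightarrow> bool"
  where "test_element G T g \<longleftrightarrow>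
    g \<in> carrier G \<and>
    (\<forall>\<phi>. continuous_endomorphism G T \<phi> \<and> \<phi> g = g \<longrightarrow> topological_automorphism G T \<phi>)"

end

theory Submission
  imports Defs "HOL-Algebra.Zassenhaus"
begin

text \<open>
  In a profinite group a primitive element lies outside the Frattini subgroup, which gives (a).
  In a finitely generated pro-\<open>p\<close> group the converse holds as well, because maximal closed
  subgroups are normal.  Now let \<open>\<phi>\<close> fix the almost primitive element \<open>g\<close>.  Then \<open>g\<close> is in the
  Frattini subgroup of \<open>G\<close>, hence \<open>g = \<phi> g\<close> is in that of \<open>\<phi>(G)\<close>, so \<open>\<phi>\<close> is onto by (a).
  Finally, finitely generated profinite groups are Hopfian.
\<close>

text \<open>Primitivity is defined by minimal generating sets, not by the Frattini subgroup, and the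
  two directions of their link are used at different groups. At closed subgroups \<open>K\<close> of
  \<open>G\<close> only one direction is used: a primitive element avoids the Frattini subgroup.
  Such a \<open>K\<close> inherits the profinite structure but may fail to be finitely generated, so
  this direction rests on compactness: every proper closed subgroup lies in a maximal one. The
  converse is used at \<open>G\<close> alone. There normality of a maximal closed subgroup
  \<open>M\<close> makes the product of \<open>M\<close> with a cyclic subgroup a subgroup again, so
  that generators can be moved into \<open>M\<close> by powers of \<open>g\<close>. Compactness acts
  throughout by way of finite index: finitely many cosets of an open subgroup cover the group, which
  reduces questions on maximal subgroups to finite sets of subgroups and to finite
  quotients.\<close>

section \<open>Maximal subgroups of finite p-groups\<close>

lemma (in group_hom) subgroup_preimage:
  assumes "subgroup L H"
  shows "subgroup {x \<in> carrier G. h x \<in> L} G"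
proof -
  interpret L: subgroup L H by (rule assms)
  show ?thesis by unfold_locales auto
qed

text \<open>The points moved by some group element split into orbits; each of these has
  \<open>p\<close>-power size by orbit-stabilizer and contains at least two points. The count takes
  place in an invariant subset \<open>A\<close> so that it fits the conjugates of one subgroup
  inside the action on all subgroups.\<close>

lemma (in group_action) prime_dvd_card_non_fixed:
  assumes p: "prime p" and ord: "Coset.order G = p ^ n"
    and A: "A \<subseteq> E" "finite A"
    and inv: "\<And>g x. g \<in> carrier G \<Longrightarrow> x \<in> A \<Longrightarrow> \<phi> g x \<in> A"
  shows "p dvd card {x \<in> A. \<exists>g\<in>carrier G. \<phi> g x \<noteq> x}"
proof -
  let ?B = "{x \<in> A. \<exists>g\<in>carrier G. \<phi> g x \<noteq> x}"
  let ?C = "orbit G \<phi> ` ?B"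
  have orb_sub: "orbit G \<phi> x \<subseteq> ?B" if x: "x \<in> ?B" for x
  proof
    fix y assume "y \<in> orbit G \<phi> x"
    then obtain g where g: "g \<in> carrier G" "\<phi> g x = y" by (auto simp: orbit_def)
    have xE: "x \<in> E" using x A by blast
    have "\<phi> (inv g) y = x" using orbit_sym_aux[OF g(1) xE g(2)] .
    moreover have "inv g \<in> carrier G"
      using g(1) group_hom group_hom.axioms(1) group.inv_closed by fast
    moreover have "y \<in> A" using inv g x by blast
    ultimately show "y \<in> ?B" using x g by (cases "x = y") auto
  qed
  have union: "\<Union>?C = ?B"
    using orb_sub orbit_refl A(1) by blast
  have "p dvd card (\<Union>?C)"
  proof (rule dvd_partition)
    show "finite (\<Union>?C)" using union A(2) by simp
    show "\<forall>c\<in>?C. p dvd card c"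
    proof
      fix c assume "c \<in> ?C"
      then obtain x where x: "x \<in> ?B" "c = orbit G \<phi> x" by blast
      then obtain g where g: "g \<in> carrier G" "\<phi> g x \<noteq> x" by blast
      have xE: "x \<in> E" using x A by blast
      have "card c dvd p ^ n"
        using orbit_stabilizer_theorem[OF xE] ord x(2) by (metis dvd_triv_left)
      then obtain i where i: "card c = p ^ i" using divides_primepow_nat[OF p] by blast
      have "x \<in> c" "\<phi> g x \<in> c" using orbit_refl[OF xE] g x(2) by (auto simp: orbit_def)
      then have "card c \<noteq> 1" using g(2) by (metis card_1_singletonE singletonD)
      then show "p dvd card c" using i by (cases i) auto
    qed
    show "\<forall>c1\<in>?C. \<forall>c2\<in>?C. c1 \<noteq> c2 \<longrightarrow> c1 \<inter> c2 = {}"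
      using disjoint_union A(1) unfolding orbits_def by blast
  qed
  then show ?thesis using union by simp
qed

text \<open>If \<open>M\<close> is self-normalizing, its conjugates are permuted by \<open>M\<close> and their number is divisible by
  \<open>p\<close>; as \<open>M\<close> itself is fixed, so is a second conjugate \<open>H\<close>, and then \<open>M\<close>
  normalizes \<open>H\<close>, which is self-normalizing too, so \<open>M = H\<close>.\<close>

lemma (in group) maximal_subgroup_of_p_group_normal:
  assumes p: "prime p" and ord: "Coset.order G = p ^ n" and M: "subgroup M G"
    and max: "\<And>L. subgroup L G \<Longrightarrow> M \<subseteq> L \<Longrightarrow> L = M \<or> L = carrier G"
  shows "M \<lhd> G"
proof (rule ccontr)
  assume not_normal: "\<not> M \<lhd> G"
  have fin: "finite (carrier G)"
    using ord p by (metis card_ge_0_finite Coset.order_def prime_gt_0_nat zero_less_power)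
  let ?E = "{H. subgroup H G}"
  define \<phi> where "\<phi> = (\<lambda>g. \<lambda>H \<in> ?E. g <# H #> inv g)"
  interpret act: group_action G ?E \<phi>
    unfolding \<phi>_def by (rule action_by_conjugation_on_subgroups_set)
  have M_E: "M \<in> ?E" using M by simp
  have \<phi>_M: "\<phi> g M = (\<lambda>m. g \<otimes> m \<otimes> inv g) ` M" for g
    using M by (auto simp: \<phi>_def l_coset_def r_coset_def)
  \<comment> \<open>Under conjugation the stabilizer of \<open>M\<close> is its normalizer. It
    contains \<open>M\<close>, and it is not the whole group as \<open>M\<close> is not normal, so
    maximality makes \<open>M\<close> self-normalizing.\<close>
  define S where "S = stabilizer G \<phi> M"
  have S: "subgroup S G" unfolding S_def by (rule act.stabilizer_subgroup[OF M_E])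
  have "M \<subseteq> S"
  proof
    fix m assume m: "m \<in> M"
    then have mG: "m \<in> carrier G" using subgroup.subset[OF M] by blast
    have "m <# M #> inv m = M"
      using coset_join3[OF mG M m] coset_join2[OF _ M subgroup.m_inv_closed[OF M m]] mG by simp
    then show "m \<in> S" using M mG by (simp add: S_def stabilizer_def \<phi>_def)
  qed
  moreover have "S \<noteq> carrier G"
  proof
    assume "S = carrier G"
    then have "\<phi> g M = M" if "g \<in> carrier G" for g using that by (auto simp: S_def stabilizer_def)
    then have "M \<lhd> G" using \<phi>_M by (intro normal_invI[OF M]) blast
    then show False using not_normal by simp
  qed
  ultimately have S_M: "S = M" "M \<noteq> carrier G" using max[OF S] by auto
  let ?A = "orbit G \<phi> M"
  have A_E: "?A \<subseteq> ?E" using act.element_image[OF _ M_E] by (fastforce simp: orbit_def)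
  have A_ne: "M \<in> ?A" by (rule act.orbit_refl[OF M_E])
  have card_A: "card ?A * card M = p ^ n"
    using act.orbit_stabilizer_theorem[OF M_E] S_M ord by (simp add: S_def)
  have finA: "finite ?A"
    using fin unfolding orbit_def by (simp add: Setcompr_eq_image)
  have "card ?A \<noteq> 1"
  proof
    assume "card ?A = 1"
    then have "?A = {M}" using A_ne by (metis card_1_singletonE singletonD)
    then have "carrier G \<subseteq> S" by (auto simp: S_def stabilizer_def orbit_def)
    then show False using S_M subgroup.subset[OF M] by blast
  qed
  moreover obtain i where "card ?A = p ^ i"
    using card_A divides_primepow_nat[OF p] by (metis dvd_triv_left)
  ultimately have p_A: "p dvd card ?A" by (cases i) auto
  obtain j where j: "card M = p ^ j"
    using card_A divides_primepow_nat[OF p] by (metis dvd_triv_right)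
  interpret actM: group_action "G\<lparr>carrier := M\<rparr>" ?E \<phi>
    unfolding group_action_def by (rule group_hom.induced_group_hom'[OF act.group_hom M])
  let ?B = "{H \<in> ?A. \<exists>m\<in>M. \<phi> m H \<noteq> H}"
  have "p dvd card ?B"
  proof -
    have "\<phi> g H \<in> ?A"
      if "g \<in> carrier (G\<lparr>carrier := M\<rparr>)" and "H \<in> ?A" for g H
    proof -
      have g: "g \<in> carrier G" using \<open>g \<in> carrier (G\<lparr>carrier := M\<rparr>)\<close> subgroup.subset[OF M] by auto
      obtain h where h: "h \<in> carrier G" "H = \<phi> h M" using \<open>H \<in> ?A\<close> by (auto simp: orbit_def)
      then have "\<phi> g H = \<phi> (g \<otimes> h) M" using act.composition_rule[OF M_E g h(1)] by simp
      then show ?thesis using g h by (auto simp: orbit_def)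
    qed
    then show ?thesis
      using actM.prime_dvd_card_non_fixed[OF p _ A_E finA] j by (simp add: Coset.order_def)
  qed
  then have "p dvd card (?A - ?B)"
    using p_A finA by (simp add: card_Diff_subset dvd_diff_nat)
  moreover have M_fix: "M \<in> ?A - ?B"
    using A_ne S_M(1) by (auto simp: S_def stabilizer_def)
  ultimately have "?A - ?B \<noteq> {M}" using p by auto
  then obtain H where H: "H \<in> ?A - ?B" "H \<noteq> M" using M_fix by blast
  obtain g where g: "g \<in> carrier G" "H = \<phi> g M" using H(1) by (auto simp: orbit_def)
  have "M \<subseteq> H"
  proof
    fix m assume m: "m \<in> M"
    then have mG: "m \<in> carrier G" using subgroup.subset[OF M] by blast
    \<comment> \<open>As \<open>m\<close> fixes the conjugate of \<open>M\<close> by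
      \<open>g\<close>, the element \<open>inv g \<otimes> m \<otimes> g\<close> normalizes
      \<open>M\<close> and so lies in \<open>M\<close>; conjugating back puts \<open>m\<close> into
      \<open>H\<close>.\<close>
    have "\<phi> (inv g \<otimes> (m \<otimes> g)) M = \<phi> (inv g) (\<phi> m H)"
      using act.composition_rule[OF M_E] g mG by simp
    also have "\<dots> = \<phi> (inv g) H" using H(1) m by auto
    also have "\<dots> = M" using act.orbit_sym_aux[OF g(1) M_E] g(2) by simp
    finally have "inv g \<otimes> (m \<otimes> g) \<in> S" using g mG by (simp add: S_def stabilizer_def)
    moreover have "m = g \<otimes> (inv g \<otimes> (m \<otimes> g)) \<otimes> inv g"
    proof -
      have "g \<otimes> (inv g \<otimes> (m \<otimes> g)) = m \<otimes> g"
        using g mG m_assoc[of g "inv g" "m \<otimes> g", symmetric] by simp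
      then show ?thesis using g mG by (simp add: m_assoc)
    qed
    ultimately show "m \<in> H" unfolding g(2) \<phi>_M S_M(1) by blast
  qed
  moreover have "finite M" using fin subgroup.subset[OF M] by (rule finite_subset[rotated])
  then have "finite H" "card H \<le> card M" unfolding g(2) \<phi>_M by (simp_all add: card_image_le)
  ultimately have "M = H" by (metis card_seteq)
  then show False using H(2) by simp
qed

section \<open>Topological groups: open, closed and generated subgroups\<close>

context topological_group
begin

lemma continuous_map_translate:
  assumes "x \<in> carrier G"
  shows "continuous_map T T (\<lambda>y. x \<otimes> y)" "continuous_map T T (\<lambda>y. y \<otimes> x)"
proof -
  have "continuous_map T (prod_topology T T) (\<lambda>y. (x, y))"
       "continuous_map T (prod_topology T T) (\<lambda>y. (y, x))"
    using assms by (auto simp: continuous_map_paired topspace_eq_carrier)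
  from this[THEN continuous_map_compose, OF continuous_mult]
  show "continuous_map T T (\<lambda>y. x \<otimes> y)" "continuous_map T T (\<lambda>y. y \<otimes> x)"
    by (simp_all only: o_def prod.case)
qed

lemma openin_translate:
  assumes "openin T U" "x \<in> carrier G"
  shows "openin T {y \<in> carrier G. x \<otimes> y \<in> U}" "openin T {y \<in> carrier G. y \<otimes> x \<in> U}"
  by (fold topspace_eq_carrier)
    (rule openin_continuous_map_preimage[OF continuous_map_translate(1)[OF assms(2)] assms(1)]
      openin_continuous_map_preimage[OF continuous_map_translate(2)[OF assms(2)] assms(1)])+

text \<open>\<open>W\<close> is the union of the open translates \<open>w V\<close> with
  \<open>w\<close> in \<open>W\<close>.\<close>

lemma openin_subgroup_superset:
  assumes W: "subgroup W G" and V: "openin T V" "\<one> \<in> V" "V \<subseteq> W"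
  shows "openin T W"
proof (subst openin_subopen, intro ballI)
  fix w assume w: "w \<in> W"
  then have wG: "w \<in> carrier G" using W subgroup.subset by blast
  let ?U = "{y \<in> carrier G. inv w \<otimes> y \<in> V}"
  have "?U \<subseteq> W"
  proof
    fix y assume y: "y \<in> ?U"
    then have "w \<otimes> (inv w \<otimes> y) \<in> W" using V(3) by (auto intro: subgroup.m_closed[OF W w])
    then show "y \<in> W" using y wG m_assoc[of w "inv w" y, symmetric] by simp
  qed
  moreover have "openin T ?U" "w \<in> ?U" using openin_translate V wG by auto
  ultimately show "\<exists>U. openin T U \<and> w \<in> U \<and> U \<subseteq> W" by blast
qed

text \<open>The complement is a union of left cosets \<open>x W\<close>, which are open by
  translation.\<close>

lemma open_subgroup_closed:
  assumes W: "subgroup W G" "openin T W"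
  shows "closed_subgroup G T W"
proof -
  have "openin T (carrier G - W)"
  proof (subst openin_subopen, intro ballI)
    fix x assume x: "x \<in> carrier G - W"
    let ?U = "{y \<in> carrier G. inv x \<otimes> y \<in> W}"
    have "?U \<subseteq> carrier G - W"
    proof safe
      fix y assume y: "y \<in> carrier G" "inv x \<otimes> y \<in> W" "y \<in> W"
      then have "y \<otimes> inv (inv x \<otimes> y) \<in> W" using W by (meson subgroupE(3,4))
      moreover have "y \<otimes> inv (inv x \<otimes> y) = x"
        using x y(1) m_assoc[of y "inv y" x, symmetric] by (simp add: inv_mult_group)
      ultimately show False using x by simp
    qed
    moreover have "openin T ?U" "x \<in> ?U"
      using openin_translate W x by (auto simp: subgroup.one_closed)
    ultimately show "\<exists>U. openin T U \<and> x \<in> U \<and> U \<subseteq> carrier G - W" by blast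
  qed
  then show ?thesis
    using W by (simp add: closed_subgroup_def closedin_def topspace_eq_carrier subgroup.subset)
qed

lemma openin_r_coset:
  assumes V: "subgroup V G" "openin T V" and x: "x \<in> carrier G"
  shows "openin T (V #> x)"
proof -
  have "V #> x = {y \<in> carrier G. y \<otimes> inv x \<in> V}"
    using subgroup.rcos_module[OF V(1) is_group x] r_coset_subset_G[OF subgroup.subset[OF V(1)] x]
    by auto
  then show ?thesis using openin_translate(2)[OF V(2)] x by simp
qed

text \<open>A continuous map carries the closure of a set into the closure of its image. For
  multiplication this is applied to \<open>K \<times> K\<close>, whose closure is the product of the
  closures.\<close>

lemma closed_subgroup_closure:
  assumes K: "subgroup K G"
  shows "closed_subgroup G T (T closure_of K)"
proof -
  have KG: "K \<subseteq> carrier G" by (rule subgroup.subset[OF K])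
  have sub: "K \<subseteq> T closure_of K" by (simp add: KG closure_of_subset topspace_eq_carrier)
  have "subgroup (T closure_of K) G"
  proof (rule subgroupI)
    show "T closure_of K \<subseteq> carrier G"
      using closure_of_subset_topspace[of T K] by (simp add: topspace_eq_carrier)
    show "T closure_of K \<noteq> {}" using sub subgroup.one_closed[OF K] by blast
  next
    fix a assume a: "a \<in> T closure_of K"
    have "(\<lambda>x. inv x) ` K \<subseteq> K" using K by (auto simp: subgroup.m_inv_closed)
    then have "(\<lambda>x. inv x) ` (T closure_of K) \<subseteq> T closure_of K"
      using continuous_map_image_closure_subset[OF continuous_inv, of K]
        closure_of_mono by fastforce
    then show "inv a \<in> T closure_of K" using a by blast
  next
    fix a b assume ab: "a \<in> T closure_of K" "b \<in> T closure_of K"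
    have "(\<lambda>(x, y). x \<otimes> y) ` (K \<times> K) \<subseteq> K" using K by (auto simp: subgroup.m_closed)
    then have "(\<lambda>(x, y). x \<otimes> y) ` ((T closure_of K) \<times> (T closure_of K)) \<subseteq> T closure_of K"
      using continuous_map_image_closure_subset[OF continuous_mult, of "K \<times> K"]
        closure_of_mono[of "(\<lambda>(x, y). x \<otimes> y) ` (K \<times> K)" K T] by (simp add: closure_of_Times)
    then show "a \<otimes> b \<in> T closure_of K" using ab by fastforce
  qed
  then show ?thesis by (simp add: closed_subgroup_def)
qed

lemma topological_group_subgroup:
  assumes K: "subgroup K G"
  shows "topological_group (G\<lparr>carrier := K\<rparr>) (subtopology T K)"
proof -
  interpret K: subgroup K G by (rule K)
  have "topspace (subtopology T K) = K" using K.subset by (auto simp: topspace_eq_carrier)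
  moreover have "continuous_map (prod_topology (subtopology T K) (subtopology T K))
      (subtopology T K) (\<lambda>(x, y). x \<otimes> y)"
    unfolding continuous_map_in_subtopology subtopology_Times[symmetric]
    by (auto intro: continuous_map_from_subtopology continuous_mult)
  moreover have "continuous_map (subtopology T K) (subtopology T K) (\<lambda>x. inv x)"
    unfolding continuous_map_in_subtopology
    by (auto intro: continuous_map_from_subtopology continuous_inv)
  then have "continuous_map (subtopology T K) (subtopology T K) (\<lambda>x. inv\<^bsub>G\<lparr>carrier := K\<rparr>\<^esub> x)"
    by (rule continuous_map_eq) (auto simp: m_inv_consistent[OF K])
  ultimately show ?thesis
    using subgroup_imp_group[OF K] by (simp add: topological_group_def topological_group_axioms_def)
qed

text \<open>The closure of the abstract subgroup generated by \<open>X\<close> is the least closed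
  subgroup above \<open>X\<close>. In this form generation fails for a subset of the group exactly
  when a proper closed subgroup contains it, which is where maximal subgroups enter.\<close>

lemma generates_iff:
  "topologically_generates G T X \<longleftrightarrow>
    X \<subseteq> carrier G \<and> (\<forall>K. closed_subgroup G T K \<longrightarrow> X \<subseteq> K \<longrightarrow> K = carrier G)"
  (is "?L \<longleftrightarrow> ?R")
proof
  assume L: ?L
  have "K = carrier G" if "closed_subgroup G T K" "X \<subseteq> K" for K
  proof -
    have "T closure_of generate G X \<subseteq> K"
      using that by (simp add: closed_subgroup_def closure_of_minimal generate_subgroup_incl)
    then show ?thesis
      using L that by (auto simp: topologically_generates_def closed_subgroup_def dest: subgroup.subset)
  qed
  then show ?R using L by (auto simp: topologically_generates_def)
next
  assume R: ?R
  then have "X \<subseteq> T closure_of generate G X"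
    using closure_of_subset[of "generate G X" T] generate_incl[of X]
    by (auto simp: topspace_eq_carrier generate.incl)
  then show ?L
    using R closed_subgroup_closure generate_is_subgroup by (simp add: topologically_generates_def)
qed

text \<open>Moves maximality inside \<open>K\<close> to a statement on closed subgroups of
  \<open>G\<close>; since \<open>K\<close> is closed, relatively closed subsets of it are
  closed.\<close>

lemma closed_subgroup_subtopology_iff:
  assumes K: "closed_subgroup G T K"
  shows "closed_subgroup (G\<lparr>carrier := K\<rparr>) (subtopology T K) L \<longleftrightarrow> closed_subgroup G T L \<and> L \<subseteq> K"
proof -
  have sK: "subgroup K G" and cK: "closedin T K" using K by (auto simp: closed_subgroup_def)
  have "subgroup L (G\<lparr>carrier := K\<rparr>) \<longleftrightarrow> subgroup L G \<and> L \<subseteq> K"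
    using incl_subgroup[OF sK] subgroup_incl[OF _ sK] subgroup.subset[of L "G\<lparr>carrier := K\<rparr>"] by auto
  then show ?thesis
    using closedin_closed_subtopology[OF cK, of L] unfolding closed_subgroup_def by blast
qed

lemma continuous_map_projection:
  assumes N: "N \<lhd> G" "openin T N"
  shows "continuous_map T (discrete_topology (carrier (G Mod N))) (\<lambda>x. N #> x)"
  unfolding continuous_map
proof (intro conjI allI impI)
  have sN: "subgroup N G" by (rule normal_imp_subgroup[OF N(1)])
  show "(\<lambda>x. N #> x) ` topspace T \<subseteq> topspace (discrete_topology (carrier (G Mod N)))"
    by (simp add: topspace_eq_carrier carrier_FactGroup)
  fix U
  show "openin T {x \<in> topspace T. N #> x \<in> U}"
  proof (subst openin_subopen, intro ballI)
    fix x assume x: "x \<in> {x \<in> topspace T. N #> x \<in> U}"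
    then have xG: "x \<in> carrier G" by (simp add: topspace_eq_carrier)
    have "N #> x \<subseteq> {x \<in> topspace T. N #> x \<in> U}"
    proof
      fix y assume y: "y \<in> N #> x"
      then have "y \<in> carrier G" using r_coset_subset_G[OF subgroup.subset[OF sN] xG] by blast
      moreover have "N #> y = N #> x" using repr_independence[OF y xG sN] by simp
      ultimately show "y \<in> {x \<in> topspace T. N #> x \<in> U}" using x by (simp add: topspace_eq_carrier)
    qed
    then show "\<exists>W. openin T W \<and> x \<in> W \<and> W \<subseteq> {x \<in> topspace T. N #> x \<in> U}"
      using openin_r_coset[OF sN N(2) xG] rcos_self[OF xG sN] by blast
  qed
qed

end

section \<open>Profinite groups: finite index and maximal closed subgroups\<close>

context profinite_group
begin

text \<open>Allows results on profinite groups to be applied to \<open>K\<close> itself. Compactness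
  comes from closedness, and small open subgroups come from intersecting those of \<open>G\<close>
  with \<open>K\<close>.\<close>

lemma profinite_group_closed_subgroup:
  assumes K: "closed_subgroup G T K"
  shows "profinite_group (G\<lparr>carrier := K\<rparr>) (subtopology T K)"
proof -
  have sK: "subgroup K G" and cK: "closedin T K" using K by (auto simp: closed_subgroup_def)
  have base: "\<exists>V. subgroup V (G\<lparr>carrier := K\<rparr>) \<and> openin (subtopology T K) V \<and> V \<subseteq> U"
    if U: "openin (subtopology T K) U" "\<one> \<in> U" for U
  proof -
    obtain U' where U': "openin T U'" "U = U' \<inter> K" using U by (auto simp: openin_subtopology)
    then obtain V where V: "subgroup V G" "openin T V" "V \<subseteq> U'"
      using open_subgroups_base U by blast
    have "subgroup (V \<inter> K) (G\<lparr>carrier := K\<rparr>)"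
      using subgroups_Inter_pair[OF V(1) sK] sK by (intro subgroup_incl) auto
    moreover have "openin (subtopology T K) (V \<inter> K)"
      using V(2) by (rule openin_subtopology_Int)
    moreover have "V \<inter> K \<subseteq> U" using V(3) U'(2) by blast
    ultimately show ?thesis by blast
  qed
  have "compact_space (subtopology T K)"
    by (rule compact_space_subtopology[OF closedin_compact_space[OF compact cK]])
  moreover have "Hausdorff_space (subtopology T K)"
    by (rule Hausdorff_space_subtopology[OF Hausdorff])
  ultimately have "profinite_group_axioms (G\<lparr>carrier := K\<rparr>) (subtopology T K)"
    using base by (simp add: profinite_group_axioms_def)
  then show ?thesis
    by (rule profinite_group.intro[OF topological_group_subgroup[OF sK]])
qed

text \<open>The cosets of \<open>V\<close> form an open cover of a compact space. Covering is all
  that is asked of \<open>F\<close>; two representatives may share a coset.\<close>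

lemma finite_transversal:
  assumes V: "subgroup V G" "openin T V"
  obtains F where "finite F" "F \<subseteq> carrier G" "carrier G = (\<Union>f\<in>F. V #> f)"
proof -
  have "topspace T \<subseteq> \<Union>((\<lambda>x. V #> x) ` carrier G)"
    using rcos_self[OF _ V(1)] by (auto simp: topspace_eq_carrier)
  then obtain \<F> where F: "finite \<F>" "\<F> \<subseteq> (\<lambda>x. V #> x) ` carrier G" "topspace T \<subseteq> \<Union>\<F>"
    using compact openin_r_coset[OF V] unfolding compact_space_alt by (metis (no_types, lifting) imageE)
  then obtain F where "finite F" "F \<subseteq> carrier G" "\<F> = (\<lambda>x. V #> x) ` F"
    by (meson finite_subset_image)
  moreover have "(\<Union>f\<in>F. V #> f) \<subseteq> carrier G"
    using \<open>F \<subseteq> carrier G\<close> r_coset_subset_G[OF subgroup.subset[OF V(1)]] by blast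
  ultimately show ?thesis using F(3) that[of F] unfolding topspace_eq_carrier by blast
qed

text \<open>A subgroup \<open>W\<close> above \<open>V\<close> is a union of cosets of
  \<open>V\<close>, so the finite set \<open>W \<inter> F\<close> of representatives determines
  it.\<close>

lemma finite_subgroups_above_open:
  assumes V: "subgroup V G" "openin T V"
  shows "finite {W. subgroup W G \<and> V \<subseteq> W}"
proof -
  obtain F where F: "finite F" "F \<subseteq> carrier G" "carrier G = (\<Union>f\<in>F. V #> f)"
    by (rule finite_transversal[OF V])
  have "W = (\<Union>f\<in>W \<inter> F. V #> f)" if W: "subgroup W G" "V \<subseteq> W" for W
  proof (intro equalityI subsetI)
    fix w assume w: "w \<in> W"
    then have wG: "w \<in> carrier G" using W(1) subgroup.subset by blast
    then obtain f v where f: "f \<in> F" "v \<in> V" "w = v \<otimes> f"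
      using F(3) by (auto simp: r_coset_def)
    have "v \<in> carrier G" "f \<in> carrier G" using f F V(1) subgroup.subset by blast+
    then have "inv v \<otimes> w = f" using f(3) m_assoc[of "inv v" v f, symmetric] by simp
    then have "f \<in> W" using W w f by (metis subgroupE(3,4) subsetD)
    then show "w \<in> (\<Union>f\<in>W \<inter> F. V #> f)" using f by (auto simp: r_coset_def)
  next
    fix w assume "w \<in> (\<Union>f\<in>W \<inter> F. V #> f)"
    then show "w \<in> W" using W by (auto simp: r_coset_def intro!: subgroup.m_closed[OF W(1)])
  qed
  then have "{W. subgroup W G \<and> V \<subseteq> W} \<subseteq> (\<lambda>S. \<Union>f\<in>S. V #> f) ` Pow F" by blast
  then show ?thesis by (rule finite_subset) (simp add: F)
qed

text \<open>\<open>N\<close> is the intersection of all conjugates of \<open>V\<close>. Conjugation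
  by elements of \<open>V\<close> preserves \<open>V\<close>, so the condition imposed by
  \<open>g\<close> depends only on the coset \<open>V g\<close>; finitely many conditions remain,
  and each is open.\<close>

lemma open_normal_core:
  assumes V: "subgroup V G" "openin T V"
  obtains N where "N \<lhd> G" "openin T N" "N \<subseteq> V"
proof
  define N where "N = {x \<in> carrier G. \<forall>g\<in>carrier G. g \<otimes> x \<otimes> inv g \<in> V}"
  interpret V: subgroup V G by (rule V)
  have sub: "subgroup N G"
  proof (rule subgroupI)
    show "N \<noteq> {}" using V.one_closed by (auto simp: N_def intro!: exI[of _ \<one>])
    fix a assume a: "a \<in> N"
    have "g \<otimes> inv a \<otimes> inv g = inv (g \<otimes> a \<otimes> inv g)" if "g \<in> carrier G" for g
      using a that by (simp add: N_def inv_mult_group m_assoc)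
    then show "inv a \<in> N" using a by (simp add: N_def)
    fix b assume b: "b \<in> N"
    have "g \<otimes> (a \<otimes> b) \<otimes> inv g = (g \<otimes> a \<otimes> inv g) \<otimes> (g \<otimes> b \<otimes> inv g)" if "g \<in> carrier G" for g
    proof -
      have "inv g \<otimes> (g \<otimes> (b \<otimes> inv g)) = b \<otimes> inv g"
        using that b m_assoc[of "inv g" g "b \<otimes> inv g", symmetric] by (simp add: N_def)
      then show ?thesis using a b that by (simp add: N_def m_assoc)
    qed
    then show "a \<otimes> b \<in> N" using a b by (simp add: N_def)
  qed (auto simp: N_def)
  show "N \<lhd> G"
  proof (rule normal_invI[OF sub])
    fix x h assume xh: "x \<in> carrier G" "h \<in> N"
    have "g \<otimes> (x \<otimes> h \<otimes> inv x) \<otimes> inv g = (g \<otimes> x) \<otimes> h \<otimes> inv (g \<otimes> x)" if "g \<in> carrier G" for g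
      using xh that by (simp add: N_def inv_mult_group m_assoc)
    then show "x \<otimes> h \<otimes> inv x \<in> N" using xh by (simp add: N_def)
  qed
  show "N \<subseteq> V"
  proof
    fix x assume "x \<in> N"
    then have "x \<in> carrier G" "\<one> \<otimes> x \<otimes> inv \<one> \<in> V" unfolding N_def by blast+
    then show "x \<in> V" by simp
  qed
  obtain F where F: "finite F" "F \<subseteq> carrier G" "carrier G = (\<Union>f\<in>F. V #> f)"
    by (rule finite_transversal[OF V])
  let ?P = "\<lambda>f. {x \<in> carrier G. f \<otimes> x \<otimes> inv f \<in> V}"
  have "F \<noteq> {}" using F(3) by auto
  have "N = (\<Inter>f\<in>F. ?P f)"
  proof (intro equalityI subsetI)
    fix x assume x: "x \<in> (\<Inter>f\<in>F. ?P f)"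
    then have xG: "x \<in> carrier G" using \<open>F \<noteq> {}\<close> by blast
    have "g \<otimes> x \<otimes> inv g \<in> V" if g: "g \<in> carrier G" for g
    proof -
      obtain f v where f: "f \<in> F" "v \<in> V" "g = v \<otimes> f" using F(3) g by (auto simp: r_coset_def)
      then have "g \<otimes> x \<otimes> inv g = v \<otimes> (f \<otimes> x \<otimes> inv f) \<otimes> inv v"
        using F(2) xG by (auto simp: inv_mult_group m_assoc)
      then show ?thesis using x f by simp
    qed
    then show "x \<in> N" using xG by (simp add: N_def)
  qed (use F(2) in \<open>auto simp: N_def\<close>)
  moreover have "openin T (?P f)" if "f \<in> F" for f
  proof -
    have f: "f \<in> carrier G" using that F(2) by blast
    have "?P f = {x \<in> carrier G. f \<otimes> x \<in> {y \<in> carrier G. y \<otimes> inv f \<in> V}}" using f by auto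
    then show ?thesis using openin_translate[OF openin_translate(2)[OF V(2)]] f by simp
  qed
  ultimately show "openin T N" using F(1) \<open>F \<noteq> {}\<close> by (metis (no_types, lifting) openin_INT2)
qed

lemma open_normal_base:
  assumes "openin T U" "\<one> \<in> U"
  obtains N where "N \<lhd> G" "openin T N" "N \<subseteq> U"
proof -
  obtain V where V: "subgroup V G" "openin T V" "V \<subseteq> U"
    using open_subgroups_base[OF assms] by blast
  obtain N where "N \<lhd> G" "openin T N" "N \<subseteq> V"
    by (rule open_normal_core[OF V(1,2)])
  then show thesis using that V(3) by blast
qed

text \<open>Finiteness of the set of subgroups above \<open>V\<close> replaces Zorn's lemma. All of
  them contain the open \<open>V\<close>, hence are open and closed, so a maximal proper abstract
  subgroup above \<open>V\<close> is a maximal closed one.\<close>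

lemma exists_maximal_closed_above_open:
  assumes V: "subgroup V G" "openin T V" "V \<noteq> carrier G"
  obtains M where "maximal_closed_subgroup G T M" "V \<subseteq> M"
proof -
  let ?S = "{W. subgroup W G \<and> V \<subseteq> W} - {carrier G}"
  have fin: "finite ?S" using finite_subgroups_above_open[OF V(1,2)] by simp
  have ne: "?S \<noteq> {}" using V(1,3) by auto
  obtain M where M: "M \<in> ?S" "\<And>W. W \<in> ?S \<Longrightarrow> M \<subseteq> W \<Longrightarrow> W = M"
    using finite_has_maximal[OF fin ne] by auto
  have "openin T M"
    using M(1) openin_subgroup_superset[of M V] V by (auto simp: subgroup.one_closed)
  then have "maximal_closed_subgroup G T M"
    using M open_subgroup_closed unfolding maximal_closed_subgroup_def closed_subgroup_def
    by blast
  then show ?thesis using that M(1) by blast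
qed

text \<open>Choose an open normal \<open>N\<close> so small that \<open>x N\<close> misses
  \<open>L\<close>. Then \<open>L N\<close> is an open subgroup that omits \<open>x\<close>, because
  \<open>x = l n\<close> would put \<open>x \<otimes> inv n = l\<close> into
  \<open>L\<close>.\<close>

lemma closed_subgroup_in_open_subgroup:
  assumes L: "closed_subgroup G T L" and x: "x \<in> carrier G" "x \<notin> L"
  obtains V where "subgroup V G" "openin T V" "L \<subseteq> V" "x \<notin> V"
proof -
  have sL: "subgroup L G" and cL: "closedin T L" using L by (auto simp: closed_subgroup_def)
  let ?U = "{y \<in> carrier G. x \<otimes> y \<in> carrier G - L}"
  have "openin T (carrier G - L)" using cL by (simp add: closedin_def topspace_eq_carrier)
  then have "openin T ?U" using x(1) by (rule openin_translate)
  moreover have "\<one> \<in> ?U" using x by simp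
  ultimately obtain N where N: "N \<lhd> G" "openin T N" "N \<subseteq> ?U" by (rule open_normal_base)
  have NG: "subgroup N G" using N(1) by (rule normal_imp_subgroup)
  show thesis
  proof
    show s: "subgroup (L <#> N) G" using mult_norm_subgroup[OF N(1) sL] commut_normal[OF sL N(1)] by simp
    have "N \<subseteq> L <#> N"
      using subgroup.one_closed[OF sL] subgroup.subset[OF NG] by (force simp: set_mult_def)
    then show "openin T (L <#> N)"
      using openin_subgroup_superset[OF s N(2) subgroup.one_closed[OF NG]] by blast
    show "L \<subseteq> L <#> N"
      using subgroup.one_closed[OF NG] subgroup.subset[OF sL] by (force simp: set_mult_def)
    show "x \<notin> L <#> N"
    proof
      assume "x \<in> L <#> N"
      then obtain l n where ln: "l \<in> L" "n \<in> N" "x = l \<otimes> n" by (auto simp: set_mult_def)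
      then have G: "l \<in> carrier G" "n \<in> carrier G"
        using subgroup.subset[OF NG] subgroup.subset[OF sL] by blast+
      have "inv n \<in> ?U" using N(3) ln subgroup.m_inv_closed[OF NG] by blast
      then have "x \<otimes> inv n \<notin> L" by simp
      then show False using ln G by (simp add: m_assoc)
    qed
  qed
qed

lemma exists_maximal_closed_subgroup:
  assumes "closed_subgroup G T L" "L \<noteq> carrier G"
  obtains M where "maximal_closed_subgroup G T M" "L \<subseteq> M"
proof -
  obtain x where "x \<in> carrier G" "x \<notin> L"
    using assms subgroup.subset by (fastforce simp: closed_subgroup_def)
  then obtain V where "subgroup V G" "openin T V" "L \<subseteq> V" "x \<notin> V"
    by (rule closed_subgroup_in_open_subgroup[OF assms(1)])
  then show thesis
  proof -
    assume V: "subgroup V G" "openin T V" "L \<subseteq> V" "x \<notin> V"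
    obtain M where "maximal_closed_subgroup G T M" "V \<subseteq> M"
      using exists_maximal_closed_above_open[OF V(1,2)] V(4) \<open>x \<in> carrier G\<close> by blast
    then show thesis using that V(3) by blast
  qed
qed

text \<open>An open subgroup above \<open>M\<close> that omits some point is closed and proper, so
  by maximality it is \<open>M\<close>.\<close>

lemma maximal_closed_subgroup_open:
  assumes "maximal_closed_subgroup G T M"
  shows "openin T M"
proof -
  have M: "closed_subgroup G T M" "M \<noteq> carrier G"
    and max: "\<And>K. closed_subgroup G T K \<Longrightarrow> M \<subseteq> K \<Longrightarrow> K = M \<or> K = carrier G"
    using assms by (auto simp: maximal_closed_subgroup_def)
  obtain x where x: "x \<in> carrier G" "x \<notin> M"
    using M subgroup.subset by (fastforce simp: closed_subgroup_def)
  then obtain V where V: "subgroup V G" "openin T V" "M \<subseteq> V" "x \<notin> V"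
    by (rule closed_subgroup_in_open_subgroup[OF M(1)])
  then have "V = M" using max[OF open_subgroup_closed] x by auto
  then show ?thesis using V by simp
qed

section \<open>Primitive elements of profinite groups\<close>

text \<open>Deprived of \<open>g\<close>, a minimal generating set lies in a proper closed subgroup
  and hence in a maximal one. If that one contained \<open>g\<close> too, it would contain a
  generating set.\<close>

lemma primitive_notin_frattini:
  assumes "primitive G T g"
  shows "g \<notin> frattini G T"
proof
  assume g: "g \<in> frattini G T"
  obtain X where X: "topologically_generates G T X" "\<not> topologically_generates G T (X - {g})" "g \<in> X"
    using assms by (auto simp: primitive_def minimal_generating_set_def)
  then obtain L where L: "closed_subgroup G T L" "X - {g} \<subseteq> L" "L \<noteq> carrier G"
    by (auto simp: generates_iff)
  obtain M where M: "maximal_closed_subgroup G T M" "L \<subseteq> M"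
    by (rule exists_maximal_closed_subgroup[OF L(1,3)])
  have "g \<in> M" using g M(1) by (auto simp: frattini_def)
  then have "X \<subseteq> M" using L(2) M(2) by blast
  then show False using X(1) M(1) by (auto simp: generates_iff maximal_closed_subgroup_def)
qed

section \<open>Open quotients and continuous endomorphisms\<close>

lemma finite_open_quotient:
  assumes N: "N \<lhd> G" "openin T N"
  shows "finite (carrier (G Mod N))"
proof -
  have sN: "subgroup N G" by (rule normal_imp_subgroup[OF N(1)])
  obtain F where F: "finite F" "F \<subseteq> carrier G" "carrier G = (\<Union>f\<in>F. N #> f)"
    by (rule finite_transversal[OF sN N(2)])
  have "carrier (G Mod N) \<subseteq> (\<lambda>f. N #> f) ` F"
  proof
    fix c assume "c \<in> carrier (G Mod N)"
    then obtain x where x: "x \<in> carrier G" "c = N #> x" by (auto simp: carrier_FactGroup)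
    then obtain f where f: "f \<in> F" "x \<in> N #> f" using F(3) by blast
    then have "N #> f = N #> x" using repr_independence[OF _ _ sN] F(2) by blast
    then show "c \<in> (\<lambda>f. N #> f) ` F" using f x by blast
  qed
  then show ?thesis using F(1) finite_surj by blast
qed

lemma closed_subgroup_image:
  assumes \<phi>: "continuous_endomorphism G T \<phi>" and R: "closed_subgroup G T R"
  shows "closed_subgroup G T (\<phi> ` R)"
proof -
  have hom: "group_hom G G \<phi>"
    using \<phi> is_group by (simp add: continuous_endomorphism_def group_hom_def group_hom_axioms_def)
  have "compactin T (\<phi> ` R)"
    using \<phi> R closedin_compact_space[OF compact]
    by (auto simp: continuous_endomorphism_def closed_subgroup_def intro: image_compactin)
  then have "closedin T (\<phi> ` R)" by (rule compactin_imp_closedin[OF Hausdorff])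
  then show ?thesis
    using group_hom.subgroup_img_is_subgroup[OF hom] R by (simp add: closed_subgroup_def)
qed

text \<open>A maximal closed subgroup of the image pulls back to a maximal closed subgroup of
  \<open>G\<close>, and the latter contains \<open>g\<close>.\<close>

lemma frattini_image:
  assumes \<phi>: "continuous_endomorphism G T \<phi>" and g: "g \<in> frattini G T"
  defines "K \<equiv> \<phi> ` carrier G"
  shows "\<phi> g \<in> frattini (G\<lparr>carrier := K\<rparr>) (subtopology T K)"
proof -
  have hom: "\<phi> \<in> hom G G" and cont: "continuous_map T T \<phi>"
    using \<phi> by (auto simp: continuous_endomorphism_def)
  interpret \<phi>: group_hom G G \<phi>
    using hom is_group by (simp add: group_hom_def group_hom_axioms_def)
  have "closed_subgroup G T (carrier G)"
    using subgroup_self closedin_topspace[of T] by (simp add: closed_subgroup_def topspace_eq_carrier)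
  then have K: "closed_subgroup G T K" unfolding K_def by (rule closed_subgroup_image[OF \<phi>])
  have gG: "g \<in> carrier G" using g by (simp add: frattini_def)
  have "\<phi> g \<in> M" if "maximal_closed_subgroup (G\<lparr>carrier := K\<rparr>) (subtopology T K) M" for M
  proof -
    have M: "closed_subgroup G T M" "M \<subseteq> K" "M \<noteq> K"
      and max: "\<And>L. closed_subgroup G T L \<Longrightarrow> L \<subseteq> K \<Longrightarrow> M \<subseteq> L \<Longrightarrow> L = M \<or> L = K"
      using that by (auto simp: maximal_closed_subgroup_def closed_subgroup_subtopology_iff[OF K])
    have sM: "subgroup M G" and cM: "closedin T M" using M(1) by (auto simp: closed_subgroup_def)
    define P where "P = {x \<in> carrier G. \<phi> x \<in> M}"
    have "subgroup P G"
      unfolding P_def by (rule \<phi>.subgroup_preimage[OF sM])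
    moreover have "closedin T P"
      using closedin_continuous_map_preimage[OF cont cM] by (simp add: P_def topspace_eq_carrier)
    ultimately have P: "closed_subgroup G T P" by (simp add: closed_subgroup_def)
    have "P \<noteq> carrier G"
    proof
      assume "P = carrier G"
      then have "K \<subseteq> M" by (auto simp: K_def P_def)
      then show False using M by blast
    qed
    moreover have "R = P \<or> R = carrier G" if R: "closed_subgroup G T R" "P \<subseteq> R" for R
    proof -
      have RG: "R \<subseteq> carrier G" using R(1) by (simp add: closed_subgroup_def subgroup.subset)
      have "M \<subseteq> \<phi> ` R"
      proof
        fix m assume m: "m \<in> M"
        then obtain x where x: "x \<in> carrier G" "m = \<phi> x" using M(2) by (auto simp: K_def)
        then show "m \<in> \<phi> ` R" using m R(2) by (auto simp: P_def)
      qed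
      moreover have "\<phi> ` R \<subseteq> K" using RG by (auto simp: K_def)
      ultimately consider "\<phi> ` R = M" | "\<phi> ` R = K"
        using max[OF closed_subgroup_image[OF \<phi> R(1)]] by blast
      then show ?thesis
      proof cases
        case 1
        then have "R \<subseteq> P" using RG by (auto simp: P_def)
        then show ?thesis using R(2) by blast
      next
        case 2
        \<comment> \<open>\<open>R\<close> contains \<open>P\<close> and therefore the kernel of
          \<open>\<phi>\<close>; a subgroup that contains the kernel and has full image is
          everything.\<close>
        have "x \<in> R" if x: "x \<in> carrier G" for x
        proof -
          obtain r where r: "r \<in> R" "\<phi> x = \<phi> r" using 2 x by (auto simp: K_def)
          then have rG: "r \<in> carrier G" using RG by blast
          have "\<phi> (x \<otimes> inv r) = \<one>" using x rG r(2) by simp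
          then have "x \<otimes> inv r \<in> R" using x rG R(2) subgroup.one_closed[OF sM] by (auto simp: P_def)
          then have "x \<otimes> inv r \<otimes> r \<in> R"
            using R(1) r(1) by (simp add: closed_subgroup_def subgroup.m_closed)
          then show "x \<in> R" using x rG by (simp add: m_assoc)
        qed
        then show ?thesis using RG by blast
      qed
    qed
    ultimately have "maximal_closed_subgroup G T P" using P by (simp add: maximal_closed_subgroup_def)
    then have "g \<in> P" using g by (simp add: frattini_def)
    then show ?thesis by (simp add: P_def)
  qed
  then show ?thesis using gG by (simp add: frattini_def K_def)
qed

text \<open>For an open normal subgroup \<open>N\<close>, precomposition with \<open>\<phi>\<close> is an injective self-map of the finite
  set of continuous homomorphisms \<open>G \<rightarrow> G/N\<close>.  So the projection factors through \<open>\<phi>\<close>, and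
  \<open>N\<close> contains the kernel of \<open>\<phi>\<close>.\<close>

lemma surjective_endomorphism_is_automorphism:
  assumes fg: "topologically_finitely_generated G T"
    and \<phi>: "continuous_endomorphism G T \<phi>" and surj: "\<phi> ` carrier G = carrier G"
  shows "topological_automorphism G T \<phi>"
proof -
  have hom: "\<phi> \<in> hom G G" and cont: "continuous_map T T \<phi>"
    using \<phi> by (auto simp: continuous_endomorphism_def)
  obtain X where X: "finite X" "X \<subseteq> carrier G"
    "\<And>K. closed_subgroup G T K \<Longrightarrow> X \<subseteq> K \<Longrightarrow> K = carrier G"
    using fg by (auto simp: topologically_finitely_generated_def generates_iff)
  have kernel_in: "x \<in> N" if N: "N \<lhd> G" "openin T N" and x: "x \<in> carrier G" "\<phi> x = \<one>" for N x
  proof -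
    interpret N: normal N G by (rule N)
    let ?Q = "G Mod N"
    let ?D = "discrete_topology (carrier ?Q)"
    interpret Q: group ?Q by (rule N.factorgroup_is_group)
    \<comment> \<open>Fixing the values off the carrier by \<open>extensional\<close> makes equality
      of functions mean equality of homomorphisms; otherwise \<open>S\<close> could be
      infinite.\<close>
    define S where "S = {\<psi> \<in> extensional (carrier G). \<psi> \<in> hom G ?Q \<and> continuous_map T ?D \<psi>}"
    have restr: "restrict \<psi> (carrier G) \<in> S" if "\<psi> \<in> hom G ?Q" "continuous_map T ?D \<psi>" for \<psi>
    proof -
      have "continuous_map T ?D (restrict \<psi> (carrier G))"
        using that(2) by (rule continuous_map_eq) (simp add: topspace_eq_carrier)
      moreover have "restrict \<psi> (carrier G) \<in> hom G ?Q"
        using that(1) by (auto simp: hom_def)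
      ultimately show ?thesis by (simp add: S_def)
    qed
    have eqI: "\<psi>1 = \<psi>2" if \<psi>: "\<psi>1 \<in> S" "\<psi>2 \<in> S" and eq: "\<And>x. x \<in> X \<Longrightarrow> \<psi>1 x = \<psi>2 x" for \<psi>1 \<psi>2
    proof -
      interpret h1: group_hom G ?Q \<psi>1
        using \<psi> is_group Q.is_group by (simp add: S_def group_hom_def group_hom_axioms_def)
      interpret h2: group_hom G ?Q \<psi>2
        using \<psi> is_group Q.is_group by (simp add: S_def group_hom_def group_hom_axioms_def)
      \<comment> \<open>The equalizer is closed because the discrete quotient is Hausdorff. Being a
        subgroup that contains the generators \<open>X\<close>, it is all of \<open>G\<close>; so
        values on the finite set \<open>X\<close> determine a member of \<open>S\<close>.\<close>
      let ?E = "{x \<in> carrier G. \<psi>1 x = \<psi>2 x}"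
      have "closedin T ?E"
        using closedin_continuous_maps_eq[of ?D T \<psi>1 \<psi>2] \<psi>
        by (simp add: S_def topspace_eq_carrier Hausdorff_space_discrete_topology)
      moreover have "subgroup ?E G"
        by (rule subgroupI) (auto intro: exI[of _ \<one>])
      ultimately have "?E = carrier G" using X(2,3) eq by (auto simp: closed_subgroup_def)
      then show ?thesis using \<psi> by (auto simp: S_def intro: extensionalityI)
    qed
    have "finite S"
    proof (rule inj_on_finite)
      show "inj_on (\<lambda>\<psi>. restrict \<psi> X) S"
        by (rule inj_onI) (metis eqI restrict_apply')
      show "(\<lambda>\<psi>. restrict \<psi> X) ` S \<subseteq> X \<rightarrow>\<^sub>E carrier ?Q"
        using X(2) by (auto simp: S_def hom_def)
      show "finite (X \<rightarrow>\<^sub>E carrier ?Q)"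
        using X(1) finite_open_quotient[OF N] by (simp add: finite_PiE)
    qed
    define \<Phi> where "\<Phi> = (\<lambda>\<psi> :: 'a \<Rightarrow> 'a set. restrict (\<psi> \<circ> \<phi>) (carrier G))"
    have "\<Phi> ` S \<subseteq> S"
      using restr Group.hom_compose[OF hom] continuous_map_compose[OF cont]
      unfolding \<Phi>_def S_def by blast
    moreover have "inj_on \<Phi> S"
    proof (rule inj_onI)
      fix \<psi>1 \<psi>2 assume \<psi>: "\<psi>1 \<in> S" "\<psi>2 \<in> S" "\<Phi> \<psi>1 = \<Phi> \<psi>2"
      \<comment> \<open>Injectivity of precomposition is where surjectivity of \<open>\<phi>\<close>
        enters: each \<open>y\<close> is some \<open>\<phi> z\<close>.\<close>
      have "\<psi>1 y = \<psi>2 y" if "y \<in> carrier G" for y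
      proof -
        have "y \<in> \<phi> ` carrier G" using that by (simp only: surj)
        then obtain z where z: "z \<in> carrier G" "y = \<phi> z" by blast
        then show ?thesis using fun_cong[OF \<psi>(3), of z] by (simp add: \<Phi>_def)
      qed
      then show "\<psi>1 = \<psi>2" using \<psi> X(2) by (intro eqI) auto
    qed
    ultimately have "\<Phi> ` S = S" using \<open>finite S\<close> by (simp add: endo_inj_surj)
    moreover have "restrict (\<lambda>x. N #> x) (carrier G) \<in> S"
      using restr[OF N.r_coset_hom_Mod continuous_map_projection[OF N]] .
    ultimately obtain \<psi> where \<psi>: "\<psi> \<in> S" "restrict (\<lambda>x. N #> x) (carrier G) = \<Phi> \<psi>" by blast
    have "N #> x = \<psi> \<one>" using fun_cong[OF \<psi>(2), of x] x by (simp add: \<Phi>_def)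
    also have "\<dots> = \<one>\<^bsub>?Q\<^esub>"
      using \<psi>(1) hom_one[OF _ is_group Q.is_group] by (simp add: S_def)
    finally show "x \<in> N" using x(1) N.subgroup_axioms coset_join1 by simp
  qed
  \<comment> \<open>The open normal subgroups meet only in the identity: points are closed, so one
    of these subgroups omits any given \<open>x \<noteq> \<one>\<close>.\<close>
  have triv: "x = \<one>" if x: "x \<in> carrier G" "\<phi> x = \<one>" for x
  proof (rule ccontr)
    assume "x \<noteq> \<one>"
    have "closedin T {x}"
      using x(1) Hausdorff by (simp add: closedin_Hausdorff_singleton topspace_eq_carrier)
    then have "openin T (carrier G - {x})" by (simp add: closedin_def topspace_eq_carrier)
    moreover have "\<one> \<in> carrier G - {x}" using \<open>x \<noteq> \<one>\<close> by simp
    ultimately obtain N where "N \<lhd> G" "openin T N" "N \<subseteq> carrier G - {x}"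
      by (rule open_normal_base)
    then show False using kernel_in x by blast
  qed
  have "inj_on \<phi> (carrier G)" using hom is_group triv by (simp add: inj_on_one_iff')
  moreover from this have "homeomorphic_map T T \<phi>"
    using continuous_imp_homeomorphic_map[OF cont compact Hausdorff] surj by (simp add: topspace_eq_carrier)
  ultimately show ?thesis
    using hom surj by (simp add: topological_automorphism_def iso_def bij_betw_def)
qed

end

section \<open>Pro-p groups: elements outside the Frattini subgroup are primitive\<close>

context pro_p_group
begin

text \<open>\<open>M\<close> is open, so it contains an open normal \<open>N\<close>, and
  \<open>G Mod N\<close> is a finite \<open>p\<close>-group in which the image of \<open>M\<close>
  is maximal. Normality then comes back from the finite case.\<close>

lemma maximal_closed_subgroup_normal:
  assumes M: "maximal_closed_subgroup G T M"
  shows "M \<lhd> G"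
proof -
  have sM: "subgroup M G" and opM: "openin T M"
    and max: "\<And>K. closed_subgroup G T K \<Longrightarrow> M \<subseteq> K \<Longrightarrow> K = M \<or> K = carrier G"
    using M maximal_closed_subgroup_open[OF M]
    by (auto simp: maximal_closed_subgroup_def closed_subgroup_def)
  obtain N where N: "N \<lhd> G" "openin T N" "N \<subseteq> M" by (rule open_normal_core[OF sM opM])
  interpret N: normal N G by (rule N)
  let ?Q = "G Mod N"
  let ?\<pi> = "\<lambda>x. N #> x"
  interpret Q: group ?Q by (rule N.factorgroup_is_group)
  interpret \<pi>: group_hom G ?Q ?\<pi>
    using N.r_coset_hom_Mod is_group Q.is_group by (simp add: group_hom_def group_hom_axioms_def)
  \<comment> \<open>Since \<open>N \<subseteq> M\<close>, the subgroup \<open>M\<close> is the full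
    preimage of its image.\<close>
  have M_iff: "x \<in> M" if x: "x \<in> carrier G" "?\<pi> x \<in> ?\<pi> ` M" for x
  proof -
    obtain m where m: "m \<in> M" "?\<pi> x = ?\<pi> m" using x(2) by blast
    have mG: "m \<in> carrier G" using m(1) subgroup.subset[OF sM] by blast
    have "x \<otimes> inv m \<in> M"
      using N.rcos_module_imp[OF is_group mG] rcos_self[OF x(1) N.subgroup_axioms] m(2) N(3) by blast
    then have "x \<otimes> inv m \<otimes> m \<in> M" using m(1) by (rule subgroup.m_closed[OF sM])
    then show ?thesis using x(1) mG by (simp add: m_assoc)
  qed
  obtain n where "card (rcosets N) = p ^ n" using open_normal_index[OF N(1,2)] by blast
  then have ord: "Coset.order ?Q = p ^ n" by (simp add: Coset.order_def FactGroup_def)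
  have "?\<pi> ` M \<lhd> ?Q"
  proof (rule Q.maximal_subgroup_of_p_group_normal[OF prime_p ord])
    show "subgroup (?\<pi> ` M) ?Q" by (rule \<pi>.subgroup_img_is_subgroup[OF sM])
    fix L assume L: "subgroup L ?Q" "?\<pi> ` M \<subseteq> L"
    \<comment> \<open>The pullback of \<open>L\<close> contains the open \<open>M\<close>, so it is
      open and thus closed; maximality among closed subgroups applies to it.\<close>
    define L' where "L' = {x \<in> carrier G. ?\<pi> x \<in> L}"
    have sL': "subgroup L' G"
      unfolding L'_def by (rule \<pi>.subgroup_preimage[OF L(1)])
    have M_L': "M \<subseteq> L'" using L(2) subgroup.subset[OF sM] by (auto simp: L'_def)
    have "openin T L'"
      using openin_subgroup_superset[OF sL' opM subgroup.one_closed[OF sM] M_L'] .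
    then have "L' = M \<or> L' = carrier G" using max[OF open_subgroup_closed[OF sL'] M_L'] by simp
    moreover have "L = ?\<pi> ` L'"
      using subgroup.subset[OF L(1)] by (auto simp: L'_def carrier_FactGroup)
    ultimately show "L = ?\<pi> ` M \<or> L = carrier ?Q" by (auto simp: carrier_FactGroup)
  qed
  show "M \<lhd> G"
  proof (rule normal_invI[OF sM])
    fix x h assume xh: "x \<in> carrier G" "h \<in> M"
    then have hG: "h \<in> carrier G" using subgroup.subset[OF sM] by blast
    have "?\<pi> (x \<otimes> h \<otimes> inv x) = ?\<pi> x \<otimes>\<^bsub>?Q\<^esub> ?\<pi> h \<otimes>\<^bsub>?Q\<^esub> inv\<^bsub>?Q\<^esub> ?\<pi> x"
      using xh(1) hG by (simp only: \<pi>.hom_mult \<pi>.hom_inv m_closed inv_closed)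
    also have "\<dots> \<in> ?\<pi> ` M"
      using Q.normal_invE(2)[OF \<open>?\<pi> ` M \<lhd> ?Q\<close>] xh \<pi>.hom_closed by blast
    finally show "x \<otimes> h \<otimes> inv x \<in> M" using M_iff xh(1) hG by simp
  qed
qed

text \<open>Modulo a maximal closed subgroup \<open>M\<close> that omits \<open>g\<close>, every generator is a power of \<open>g\<close>.  Hence \<open>g\<close>
  and finitely many elements of \<open>M\<close> generate \<open>G\<close>, and no generating subset of these can omit \<open>g\<close>.\<close>

lemma primitive_if_notin_frattini:
  assumes fg: "topologically_finitely_generated G T"
    and g: "g \<in> carrier G" "g \<notin> frattini G T"
  shows "primitive G T g"
proof -
  obtain M where M: "maximal_closed_subgroup G T M" "g \<notin> M" using g by (auto simp: frattini_def)
  have sM: "subgroup M G" and max: "\<And>K. closed_subgroup G T K \<Longrightarrow> M \<subseteq> K \<Longrightarrow> K = M \<or> K = carrier G"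
    and M_ne: "M \<noteq> carrier G" and cM: "closed_subgroup G T M"
    using M(1) by (auto simp: maximal_closed_subgroup_def closed_subgroup_def)
  have nM: "M \<lhd> G" by (rule maximal_closed_subgroup_normal[OF M(1)])
  obtain Y where Y: "finite Y" "topologically_generates G T Y"
    using fg by (auto simp: topologically_finitely_generated_def)
  have YG: "Y \<subseteq> carrier G" using Y(2) by (simp add: topologically_generates_def)
  \<comment> \<open>The abstract cyclic subgroup suffices, without closure: its product with the
    open \<open>M\<close> is open, hence closed.\<close>
  let ?C = "generate G {g}"
  have sC: "subgroup ?C G" using generate_is_subgroup[of "{g}"] g(1) by simp
  have sCM: "subgroup (?C <#> M) G"
    using mult_norm_subgroup[OF nM sC] commut_normal[OF sC nM] by simp
  have M_CM: "M \<subseteq> ?C <#> M"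
    using subgroup.one_closed[OF sC] subgroup.subset[OF sM] by (force simp: set_mult_def)
  have "g \<otimes> \<one> \<in> ?C <#> M"
    using generate.incl[of g "{g}"] subgroup.one_closed[OF sM] by (fastforce simp: set_mult_def)
  then have "?C <#> M \<noteq> M" using M(2) g(1) by auto
  moreover have "openin T (?C <#> M)"
    using openin_subgroup_superset[OF sCM maximal_closed_subgroup_open[OF M(1)] _ M_CM]
      subgroup.one_closed[OF sM] by blast
  ultimately have CM: "?C <#> M = carrier G" using max[OF open_subgroup_closed[OF sCM] M_CM] by blast
  have "\<exists>m\<in>M. \<exists>c\<in>?C. y = c \<otimes> m" if "y \<in> Y" for y
    using that YG unfolding CM[symmetric] set_mult_def by blast
  then obtain m where m: "\<And>y. y \<in> Y \<Longrightarrow> m y \<in> M \<and> (\<exists>c\<in>?C. y = c \<otimes> m y)" by metis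
  let ?X = "insert g (m ` Y)"
  have genX: "topologically_generates G T ?X"
    unfolding generates_iff
  proof (intro conjI allI impI)
    show "?X \<subseteq> carrier G" using g(1) m subgroup.subset[OF sM] by blast
    fix K assume K: "closed_subgroup G T K" "?X \<subseteq> K"
    then have sK: "subgroup K G" by (simp add: closed_subgroup_def)
    have "?C \<subseteq> K" using generate_subgroup_incl[OF _ sK] K(2) by blast
    then have "y \<in> K" if "y \<in> Y" for y
      using m[OF that] K(2) that subgroup.m_closed[OF sK] by (metis image_subset_iff insert_subset subsetD)
    then show "K = carrier G" using Y(2) K(1) by (auto simp: generates_iff)
  qed
  \<comment> \<open>Some of the elements \<open>m y\<close> may be redundant, so a minimal
    generating subset is extracted from the finite \<open>?X\<close>. It has to retain
    \<open>g\<close>, as the other elements all lie in the proper closed subgroup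
    \<open>M\<close>.\<close>
  let ?S = "{Z. Z \<subseteq> ?X \<and> topologically_generates G T Z}"
  have "?S \<subseteq> Pow ?X" by blast
  then have fin: "finite ?S" by (rule finite_subset) (simp add: Y(1))
  have ne: "?S \<noteq> {}" using genX by blast
  obtain Z where Z: "Z \<in> ?S" "\<And>W. W \<in> ?S \<Longrightarrow> W \<subseteq> Z \<Longrightarrow> W = Z"
    using finite_has_minimal[OF fin ne] by metis
  have "minimal_generating_set G T Z"
    unfolding minimal_generating_set_def using Z by blast
  moreover have "g \<in> Z"
  proof (rule ccontr)
    assume "g \<notin> Z"
    then have "Z \<subseteq> M" using Z(1) m by blast
    then show False using Z(1) cM M_ne by (auto simp: generates_iff)
  qed
  ultimately show ?thesis by (auto simp: primitive_def)
qed

end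

section \<open>Almost primitive elements and test elements\<close>

theorem proposition5p10:
  fixes G :: "('a, 'b) monoid_scheme" and T :: "'a topology" and p :: nat and H :: "'a set"
  assumes "prime p"
    and "pro_p_group G T p"
    and "topologically_finitely_generated G T"
    and "closed_subgroup G T H"
  shows "((\<exists>g \<in> frattini (G\<lparr>carrier := H\<rparr>) (subtopology T H). almost_primitive G T g)
            \<longrightarrow> H = carrier G)
       \<and> (\<forall>g. almost_primitive G T g \<longrightarrow> test_element G T g)"
proof -
  interpret pro_p_group G T p by (rule assms(2))
  \<comment> \<open>Stated for arbitrary closed \<open>K\<close> because it serves twice: with
    \<open>K = H\<close> it is (a), and with \<open>K\<close> the image of an endomorphism it gives
    the surjectivity needed in (b).\<close>
  have frattini_whole: "K = carrier G"
    if K: "closed_subgroup G T K" and g: "almost_primitive G T g"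
      "g \<in> frattini (G\<lparr>carrier := K\<rparr>) (subtopology T K)" for K g
  proof (rule ccontr)
    assume "K \<noteq> carrier G"
    moreover have "g \<in> K" using g(2) by (simp add: frattini_def)
    ultimately have "primitive (G\<lparr>carrier := K\<rparr>) (subtopology T K) g"
      using g(1) K by (simp add: almost_primitive_def)
    then show False
      using profinite_group.primitive_notin_frattini[OF profinite_group_closed_subgroup[OF K]] g(2)
      by blast
  qed
  have "test_element G T g" if g: "almost_primitive G T g" for g
    unfolding test_element_def
  proof (intro conjI allI impI; (elim conjE)?)
    show gG: "g \<in> carrier G" using g by (simp add: almost_primitive_def)
    fix \<phi> assume \<phi>: "continuous_endomorphism G T \<phi>" "\<phi> g = g"
    have "g \<in> frattini G T"
      using g primitive_if_notin_frattini[OF assms(3) gG] by (auto simp: almost_primitive_def)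
    then have "g \<in> frattini (G\<lparr>carrier := \<phi> ` carrier G\<rparr>) (subtopology T (\<phi> ` carrier G))"
      using frattini_image[OF \<phi>(1)] \<phi>(2) by metis
    moreover have "closed_subgroup G T (\<phi> ` carrier G)"
      using closed_subgroup_image[OF \<phi>(1)] subgroup_self closedin_topspace[of T]
      by (simp add: closed_subgroup_def topspace_eq_carrier)
    ultimately have "\<phi> ` carrier G = carrier G" using frattini_whole g by blast
    then show "topological_automorphism G T \<phi>"
      by (rule surjective_endomorphism_is_automorphism[OF assms(3) \<phi>(1)])
  qed
  then show ?thesis using frattini_whole[OF assms(4)] by blast
qed

end
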